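(* Let $\Omega$ be a nonempty finite set. The function $\psi$ (defined in the context) from the set of all finite sets of labelled digraphs on $\Omega$ to the set $\mathcal{O}$ of all extended graphs on $\Omega$ is well-defined, injective, and $\operatorname{Sym}(\Omega)$-invariant. Consequently, for all finite sets $A,B$ of labelled digraphs on $\Omega$, the pair of constant functions on $\operatorname{Stacks}(\mathcal{O})$ with images the one-entry stacks $[\psi(A)]$ and $[\psi(B)]$ is a perfect refiner for $\operatorname{Transp}(A,B)$ in extended graph backtracking.
   Context: Actions are right actions, written by exponentiation. A digraph on a set $V$ is a pair $(V,A)$ with arc set $A \subseteq V\times V$ (loops allowed); a labelled digraph on $V$ additionally has a label assigned to each vertex and each arc. $\operatorname{Sym}(V)$ acts on labelled digraphs on $V$ by renaming vertices (carrying labels along). Any action of $\operatorname{Sym}(\Omega)$ on a set induces actions elementwise on its subsets and entrywise on finite lists of its elements. A function $f:X\to Y$ between sets on which $\operatorname{Sym}(\Omega)$ acts is $\operatorname{Sym}(\Omega)$-invariant if $f(x^g)=f(x)^g$ for all $x\in X$, $g\in\operatorname{Sym}(\Omega)$. Fix an infinite well-ordered set $\Lambda\supseteq\Omega$ with $\alpha<\beta$ for all $\alpha\in\Omega$, $\beta\in\Lambda\setminus\Omega$. For $\Omega\subseteq V\subseteq\Lambda$, regard $\operatorname{Sym}(\Omega)$ and $\operatorname{Sym}(V\setminus\Omega)$ as (commuting) subgroups of $\operatorname{Sym}(V)$. An extended graph on $\Omega$ is an orbit $\overline{\Gamma}$ of $\operatorname{Sym}(V\setminus\Omega)$ on the set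 of labelled digraphs on $V$, for some finite $V$ with $\Omega\subseteq V\subseteq\Lambda$. $\operatorname{Sym}(\Omega)$ acts by $(\overline{\Gamma})^g=\overline{\Gamma^g}$. Fix two distinct labels $\#$ and $\circledast$ that are not allowed as labels in the labelled digraphs on $\Omega$ that form the members of the sets to which $\psi$ is applied (they are allowed in extended graphs). Given $A=\{\Gamma_1,\dots,\Gamma_k\}$, $k\geq 0$, indexed arbitrarily, let $\{V_1,\dots,V_k\}$ be an arbitrary partition of the least $k|\Omega|$ elements of $\Lambda\setminus\Omega$ into parts of size $|\Omega|$, let $\tau_i:\Omega\to V_i$ be arbitrary bijections, and let $X=\{x_1,\dots,x_k\}$ be the least $k$ elements of $\Lambda\setminus(\Omega\cup V_1\cup\dots\cup V_k)$, indexed arbitrarily. Then $\psi(A)$ is the extended graph containing the labelled digraph on $\Omega\cup V_1\cup\dots\cup V_k\cup X$ with arcs $$\bigcup_{i=1}^k\Big(\{(\tau_i(\alpha),\alpha),(\tau_i(\alpha),x_i):\alpha\in\Omega\}\cup\{(\tau_i(\alpha),\tau_i(\beta)):(\alpha,\beta)\text{ is an arc of }\Gamma_i\}\Big),$$ where vertices in $\Omega$ and arcs ending in $\Omega$ are labelled $\#$, vertices in $X$ and arcs ending in $X$ are labelled $\circledast$, the vertex $\tau_i(\alpha)$ has the label of $\alpha$ in $\Gamma_i$, and the arc $(\tau_i(\alpha),\tau_i(\beta))$ (if present) has the label of $(\alpha,\beta)$ in $\Gamma_i$. For a set $\mathcal{O}$ on which $\operatorname{Sym}(\Omega)$ acts,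 $\operatorname{Stacks}(\mathcal{O})$ is the set of all finite lists (including the empty one) with entries in $\mathcal{O}$; $|S|$ is length and $\Vert$ is concatenation. $\operatorname{Transp}(x,y) = \{g\in\operatorname{Sym}(\Omega) : x^g=y\}$. A refiner for $U\subseteq\operatorname{Sym}(\Omega)$ (with respect to $\mathcal{O}$) is a pair $(f_L,f_R)$ of functions from $\operatorname{Stacks}(\mathcal{O})$ to itself such that $U\cap\operatorname{Transp}(S,T)\subseteq\operatorname{Transp}(f_L(S),f_R(T))$ for all $S,T$. It is perfect if $U\cap\operatorname{Transp}(S,T)=\operatorname{Transp}(S\Vert f_L(S),\,T\Vert f_R(T))$ for all $S,T$ with $|S|=|T|$. Extended graph backtracking is the case where $\mathcal{O}$ is the set of all extended graphs on $\Omega$. *)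

theory Defs
  imports "HOL-Combinatorics.Permutations" "HOL-Library.FuncSet" "HOL-Library.Disjoint_Sets"
begin

text \<open>
  \<open>Sym(\<Omega>)\<close> is the set of all \<open>g\<close> with \<open>g permutes \<Omega>\<close>. As such a \<open>g\<close> fixes every point outside
  \<open>\<Omega>\<close>, both \<open>Sym(\<Omega>)\<close> and \<open>Sym(V - \<Omega>)\<close> are literally subsets of \<open>Sym(V)\<close> for \<open>\<Omega> \<subseteq> V\<close>.
  The image \<open>x\<^sup>g\<close> of a point is \<open>g x\<close>. An action on a type is given by a function \<open>act\<close>,
  with \<open>act g x\<close> standing for \<open>x\<^sup>g\<close>.
\<close>

section \<open>Labelled digraphs\<close>

record ('a, 'l) ldigraph =
  verts :: "'a set"
  arcs :: "('a \<times> 'a) set"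
  vlabel :: "'a \<rightharpoonup> 'l"
  alabel :: "'a \<times> 'a \<rightharpoonup> 'l"

text \<open>The label maps are defined exactly on the vertices and arcs, so that HOL equality of records
  is equality of labelled digraphs.\<close>

definition ldigraphs_on :: "'a set \<Rightarrow> ('a, 'l) ldigraph set" where
  "ldigraphs_on V = {G. verts G = V \<and> arcs G \<subseteq> V \<times> V \<and> dom (vlabel G) = V \<and> dom (alabel G) = arcs G}"

definition act_ldigraph :: "('a \<Rightarrow> 'a) \<Rightarrow> ('a, 'l) ldigraph \<Rightarrow> ('a, 'l) ldigraph" where
  "act_ldigraph g G =
    \<lparr>verts = g ` verts G,
     arcs = map_prod g g ` arcs G,
     vlabel = vlabel G \<circ> inv g,
     alabel = alabel G \<circ> map_prod (inv g) (inv g)\<rparr>"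

definition act_set :: "(('a \<Rightarrow> 'a) \<Rightarrow> 'x \<Rightarrow> 'x) \<Rightarrow> ('a \<Rightarrow> 'a) \<Rightarrow> 'x set \<Rightarrow> 'x set" where
  "act_set act g A = act g ` A"

definition act_list :: "(('a \<Rightarrow> 'a) \<Rightarrow> 'x \<Rightarrow> 'x) \<Rightarrow> ('a \<Rightarrow> 'a) \<Rightarrow> 'x list \<Rightarrow> 'x list" where
  "act_list act g S = map (act g) S"

definition sym_invariant ::
  "'a set \<Rightarrow> (('a \<Rightarrow> 'a) \<Rightarrow> 'x \<Rightarrow> 'x) \<Rightarrow> (('a \<Rightarrow> 'a) \<Rightarrow> 'y \<Rightarrow> 'y) \<Rightarrow> 'x set \<Rightarrow> ('x \<Rightarrow> 'y) \<Rightarrow> bool" where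
  "sym_invariant \<Omega> actX actY X f \<longleftrightarrow> (\<forall>x\<in>X. \<forall>g. g permutes \<Omega> \<longrightarrow> f (actX g x) = actY g (f x))"


section \<open>Extended graphs\<close>

definition extended_graph_of :: "'a set \<Rightarrow> ('a, 'l) ldigraph \<Rightarrow> ('a, 'l) ldigraph set" where
  "extended_graph_of \<Omega> G = {act_ldigraph h G | h. h permutes (verts G - \<Omega>)}"

definition extended_graphs :: "'a set \<Rightarrow> 'a set \<Rightarrow> ('a, 'l) ldigraph set set" where
  "extended_graphs \<Omega> \<Lambda> =
    {extended_graph_of \<Omega> G | G V. finite V \<and> \<Omega> \<subseteq> V \<and> V \<subseteq> \<Lambda> \<and> G \<in> ldigraphs_on V}"

text \<open>The action on extended graphs is the elementwise one; \<open>act_extended_graph_of\<close> below shows that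
  it sends the orbit of \<open>\<Gamma>\<close> to the orbit of \<open>\<Gamma>\<^sup>g\<close>.\<close>

definition act_extended_graph ::
  "('a \<Rightarrow> 'a) \<Rightarrow> ('a, 'l) ldigraph set \<Rightarrow> ('a, 'l) ldigraph set" where
  "act_extended_graph = act_set act_ldigraph"

lemma act_ldigraph_comp:
  assumes "bij g" "bij h"
  shows "act_ldigraph (h \<circ> g) G = act_ldigraph h (act_ldigraph g G)"
  using assms
  by (simp add: act_ldigraph_def o_inv_distrib image_comp map_prod_compose comp_assoc)

lemma permutes_disjoint_commute:
  assumes g: "g permutes A" and h: "h permutes B" and AB: "A \<inter> B = {}"
  shows "g \<circ> h = h \<circ> g"
proof
  fix x
  have A: "g y \<in> A \<longleftrightarrow> y \<in> A" for y by (rule permutes_in_image[OF g])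
  have B: "h y \<in> B \<longleftrightarrow> y \<in> B" for y by (rule permutes_in_image[OF h])
  have gn: "y \<notin> A \<Longrightarrow> g y = y" for y by (rule permutes_not_in[OF g])
  have hn: "y \<notin> B \<Longrightarrow> h y = y" for y by (rule permutes_not_in[OF h])
  consider "x \<in> A" | "x \<in> B" | "x \<notin> A" "x \<notin> B" by blast
  then show "(g \<circ> h) x = (h \<circ> g) x"
  proof cases
    case 1
    then have "x \<notin> B" "g x \<notin> B" using A AB by blast+
    then show ?thesis by (simp add: hn)
  next
    case 2
    then have "x \<notin> A" "h x \<notin> A" using B AB by blast+
    then show ?thesis by (simp add: gn)
  qed (simp add: gn hn)
qed

lemma act_extended_graph_of:
  assumes g: "g permutes \<Omega>" and sub: "\<Omega> \<subseteq> verts G"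
  shows "act_extended_graph g (extended_graph_of \<Omega> G) = extended_graph_of \<Omega> (act_ldigraph g G)"
proof -
  have "g permutes verts G" using g sub by (rule permutes_subset)
  then have v: "verts (act_ldigraph g G) = verts G"
    by (simp add: act_ldigraph_def permutes_image)
  have c: "act_ldigraph g (act_ldigraph h G) = act_ldigraph h (act_ldigraph g G)"
    if h: "h permutes (verts G - \<Omega>)" for h
  proof -
    have "g \<circ> h = h \<circ> g" by (rule permutes_disjoint_commute[OF g h]) blast
    then show ?thesis
      using permutes_bij[OF g] permutes_bij[OF h] by (metis act_ldigraph_comp)
  qed
  show ?thesis
    unfolding act_extended_graph_def act_set_def extended_graph_of_def v
    using c by (auto simp: image_iff) metis
qed


section \<open>The function \<open>\<psi>\<close>\<close>

text \<open>Throughout, \<open>r\<close> is a (reflexive) well-order on \<open>\<Lambda>\<close>, and \<open>hash\<close> and \<open>circast\<close> are the two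
  reserved labels.\<close>

definition plain_ldigraphs :: "'a set \<Rightarrow> 'l \<Rightarrow> 'l \<Rightarrow> ('a, 'l) ldigraph set" where
  "plain_ldigraphs \<Omega> hash circast =
    {G \<in> ldigraphs_on \<Omega>. (ran (vlabel G) \<union> ran (alabel G)) \<inter> {hash, circast} = {}}"

definition finite_ldigraph_sets :: "'a set \<Rightarrow> 'l \<Rightarrow> 'l \<Rightarrow> ('a, 'l) ldigraph set set" where
  "finite_ldigraph_sets \<Omega> hash circast = {A. finite A \<and> A \<subseteq> plain_ldigraphs \<Omega> hash circast}"

text \<open>\<open>T\<close> consists of the least \<open>m\<close> elements of \<open>S\<close>.\<close>

definition least_elements :: "'a rel \<Rightarrow> nat \<Rightarrow> 'a set \<Rightarrow> 'a set \<Rightarrow> bool" where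
  "least_elements r m S T \<longleftrightarrow>
    T \<subseteq> S \<and> finite T \<and> card T = m \<and> (\<forall>t\<in>T. \<forall>s\<in>S - T. (t, s) \<in> r)"

text \<open>The admissible choices: an indexing \<open>\<Gamma>\<close> of \<open>A\<close>, a partition \<open>V\<close>, bijections \<open>\<tau> i\<close>
  and an indexing \<open>x\<close> of \<open>X\<close>.\<close>

definition psi_choice ::
  "'a set \<Rightarrow> 'a set \<Rightarrow> 'a rel \<Rightarrow> ('a, 'l) ldigraph set \<Rightarrow> nat \<Rightarrow> (nat \<Rightarrow> ('a, 'l) ldigraph)
    \<Rightarrow> (nat \<Rightarrow> 'a set) \<Rightarrow> (nat \<Rightarrow> 'a \<Rightarrow> 'a) \<Rightarrow> (nat \<Rightarrow> 'a) \<Rightarrow> bool" where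
  "psi_choice \<Omega> \<Lambda> r A k \<Gamma> V \<tau> x \<longleftrightarrow>
    bij_betw \<Gamma> {1..k} A \<and>
    disjoint_family_on V {1..k} \<and>
    (\<forall>i\<in>{1..k}. card (V i) = card \<Omega>) \<and>
    least_elements r (k * card \<Omega>) (\<Lambda> - \<Omega>) (\<Union>i\<in>{1..k}. V i) \<and>
    (\<forall>i\<in>{1..k}. bij_betw (\<tau> i) \<Omega> (V i)) \<and>
    inj_on x {1..k} \<and>
    least_elements r k (\<Lambda> - (\<Omega> \<union> (\<Union>i\<in>{1..k}. V i))) (x ` {1..k})"

definition psi_verts :: "'a set \<Rightarrow> nat \<Rightarrow> (nat \<Rightarrow> 'a \<Rightarrow> 'a) \<Rightarrow> (nat \<Rightarrow> 'a) \<Rightarrow> 'a set" where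
  "psi_verts \<Omega> k \<tau> x = \<Omega> \<union> (\<Union>i\<in>{1..k}. \<tau> i ` \<Omega>) \<union> x ` {1..k}"

definition psi_arcs ::
  "'a set \<Rightarrow> nat \<Rightarrow> (nat \<Rightarrow> ('a, 'l) ldigraph) \<Rightarrow> (nat \<Rightarrow> 'a \<Rightarrow> 'a) \<Rightarrow> (nat \<Rightarrow> 'a) \<Rightarrow> ('a \<times> 'a) set" where
  "psi_arcs \<Omega> k \<Gamma> \<tau> x =
    (\<Union>i\<in>{1..k}. (\<Union>\<alpha>\<in>\<Omega>. {(\<tau> i \<alpha>, \<alpha>), (\<tau> i \<alpha>, x i)}) \<union>
                {(\<tau> i \<alpha>, \<tau> i \<beta>) | \<alpha> \<beta>. (\<alpha>, \<beta>) \<in> arcs (\<Gamma> i)})"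

definition psi_ldigraph ::
  "'a set \<Rightarrow> 'l \<Rightarrow> 'l \<Rightarrow> nat \<Rightarrow> (nat \<Rightarrow> ('a, 'l) ldigraph) \<Rightarrow> (nat \<Rightarrow> 'a \<Rightarrow> 'a) \<Rightarrow> (nat \<Rightarrow> 'a)
    \<Rightarrow> ('a, 'l) ldigraph" where
  "psi_ldigraph \<Omega> hash circast k \<Gamma> \<tau> x =
    \<lparr>verts = psi_verts \<Omega> k \<tau> x,
     arcs = psi_arcs \<Omega> k \<Gamma> \<tau> x,
     vlabel = (\<lambda>v.
       if v \<notin> psi_verts \<Omega> k \<tau> x then None
       else if v \<in> \<Omega> then Some hash
       else if v \<in> x ` {1..k} then Some circast
       else (THE l. \<exists>i\<in>{1..k}. \<exists>\<alpha>\<in>\<Omega>. v = \<tau> i \<alpha> \<and> l = vlabel (\<Gamma> i) \<alpha>)),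
     alabel = (\<lambda>e.
       if e \<notin> psi_arcs \<Omega> k \<Gamma> \<tau> x then None
       else if snd e \<in> \<Omega> then Some hash
       else if snd e \<in> x ` {1..k} then Some circast
       else (THE l. \<exists>i\<in>{1..k}. \<exists>\<alpha> \<beta>. (\<alpha>, \<beta>) \<in> arcs (\<Gamma> i) \<and> e = (\<tau> i \<alpha>, \<tau> i \<beta>) \<and>
                      l = alabel (\<Gamma> i) (\<alpha>, \<beta>)))\<rparr>"

text \<open>\<open>E\<close> is the extended graph resulting from some admissible choice; \<open>\<psi>\<close> is well-defined at \<open>A\<close>
  if there is exactly one such \<open>E\<close>.\<close>

definition psi_value ::
  "'a set \<Rightarrow> 'a set \<Rightarrow> 'a rel \<Rightarrow> 'l \<Rightarrow> 'l \<Rightarrow> ('a, 'l) ldigraph set \<Rightarrow> ('a, 'l) ldigraph set \<Rightarrow> bool" where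
  "psi_value \<Omega> \<Lambda> r hash circast A E \<longleftrightarrow>
    (\<exists>k \<Gamma> V \<tau> x. psi_choice \<Omega> \<Lambda> r A k \<Gamma> V \<tau> x \<and>
       E = extended_graph_of \<Omega> (psi_ldigraph \<Omega> hash circast k \<Gamma> \<tau> x))"

definition psi ::
  "'a set \<Rightarrow> 'a set \<Rightarrow> 'a rel \<Rightarrow> 'l \<Rightarrow> 'l \<Rightarrow> ('a, 'l) ldigraph set \<Rightarrow> ('a, 'l) ldigraph set" where
  "psi \<Omega> \<Lambda> r hash circast A = (THE E. psi_value \<Omega> \<Lambda> r hash circast A E)"


section \<open>Stacks and refiners\<close>

definition Stacks :: "'x set \<Rightarrow> 'x list set" where
  "Stacks O' = lists O'"

definition Transp :: "'a set \<Rightarrow> (('a \<Rightarrow> 'a) \<Rightarrow> 'x \<Rightarrow> 'x) \<Rightarrow> 'x \<Rightarrow> 'x \<Rightarrow> ('a \<Rightarrow> 'a) set" where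
  "Transp \<Omega> act x y = {g. g permutes \<Omega> \<and> act g x = y}"

definition refiner ::
  "'a set \<Rightarrow> (('a \<Rightarrow> 'a) \<Rightarrow> 'x \<Rightarrow> 'x) \<Rightarrow> 'x set \<Rightarrow> ('a \<Rightarrow> 'a) set
    \<Rightarrow> ('x list \<Rightarrow> 'x list) \<Rightarrow> ('x list \<Rightarrow> 'x list) \<Rightarrow> bool" where
  "refiner \<Omega> act O' U fL fR \<longleftrightarrow>
    U \<subseteq> {g. g permutes \<Omega>} \<and>
    fL \<in> Stacks O' \<rightarrow> Stacks O' \<and> fR \<in> Stacks O' \<rightarrow> Stacks O' \<and>
    (\<forall>S\<in>Stacks O'. \<forall>T\<in>Stacks O'.
       U \<inter> Transp \<Omega> (act_list act) S T \<subseteq> Transp \<Omega> (act_list act) (fL S) (fR T))"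

definition perfect_refiner ::
  "'a set \<Rightarrow> (('a \<Rightarrow> 'a) \<Rightarrow> 'x \<Rightarrow> 'x) \<Rightarrow> 'x set \<Rightarrow> ('a \<Rightarrow> 'a) set
    \<Rightarrow> ('x list \<Rightarrow> 'x list) \<Rightarrow> ('x list \<Rightarrow> 'x list) \<Rightarrow> bool" where
  "perfect_refiner \<Omega> act O' U fL fR \<longleftrightarrow>
    refiner \<Omega> act O' U fL fR \<and>
    (\<forall>S\<in>Stacks O'. \<forall>T\<in>Stacks O'. length S = length T \<longrightarrow>
       U \<inter> Transp \<Omega> (act_list act) S T = Transp \<Omega> (act_list act) (S @ fL S) (T @ fR T))"

end

(* Every Gamma in A can be read off from psi(A): it is the digraph for which some vertex labelled
   circast has an in-neighbour t(alpha) joined to alpha for each alpha in Omega, such that the labels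
   on the t(alpha) and on the pairs (t(alpha), t(beta)) are those of Gamma. This description is
   invariant under the permutations fixing Omega pointwise, so psi is injective. Well-definedness and
   invariance both come from one observation: a permutation carrying the tau i and x i of one choice
   to those of another one, up to reindexing and up to an element g of Sym(Omega), carries the first
   digraph to the second one. *)
theory Submission
  imports Defs
begin

section \<open>Least elements of subsets of a well-ordered set\<close>

text \<open>The two kinds of extra arcs make the reading unambiguous. All in-neighbours of
  \<open>x i\<close> lie in the \<open>i\<close>-th copy of \<Omega>, and all in-neighbours of a
  point \<alpha> of \<Omega> are copies of \<alpha>; being joined to both \<open>x i\<close> and
  \<alpha> therefore pins down \<open>\<tau> i \<alpha>\<close>. The reserved labels single out the
  \<open>x i\<close>: a copied vertex carries a label from a member of A, hence never
  \<open>circast\<close>, and the points of \<Omega> carry \<open>hash\<close>. An extended graph is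
  an orbit of Sym(V - \<Omega>) for one fixed V, so two choices must agree on the vertex set before
  they can be compared. The well-order achieves this: the least elements in a given number form a
  unique set, and what remains free in a choice is undone by a permutation of that set.\<close>

lemma well_order_on_has_least:
  assumes "well_order_on \<Lambda> r" "S \<subseteq> \<Lambda>" "S \<noteq> {}"
  obtains m where "m \<in> S" "\<And>s. s \<in> S \<Longrightarrow> (m, s) \<in> r"
proof -
  have wf: "wf (r - Id)" and tot: "total_on \<Lambda> r" and refl: "refl_on \<Lambda> r"
    using assms(1)
    by (simp_all add: well_order_on_def linear_order_on_def partial_order_on_def preorder_on_def)
  obtain m where m: "m \<in> S" "\<And>y. (y, m) \<in> r - Id \<Longrightarrow> y \<notin> S"
    using wfE_min[OF wf] assms(3) by (metis all_not_in_conv)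
  \<comment> \<open>Well-foundedness yields only a minimal element; totality makes it a least
    one.\<close>
  have "(m, s) \<in> r" if "s \<in> S" for s
  proof (cases "s = m")
    case True
    then show ?thesis using refl m(1) assms(2) by (auto simp: refl_on_def)
  next
    case False
    then show ?thesis
      using tot m that assms(2) unfolding total_on_def by blast
  qed
  with m(1) show ?thesis by (rule that)
qed

lemma least_elements_subset: "least_elements r m S T \<Longrightarrow> T \<subseteq> S"
  by (simp add: least_elements_def)

text \<open>The next element is the least one of \<open>S - T\<close>, which is nonempty because S
  is infinite and T finite. It lies below everything that still remains, as do the elements of
  T.\<close>

lemma least_elements_exist:
  assumes "well_order_on \<Lambda> r" "S \<subseteq> \<Lambda>" "infinite S"
  shows "\<exists>T. least_elements r m S T"
proof (induction m)
  case 0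
  then show ?case by (auto simp: least_elements_def)
next
  case (Suc m)
  then obtain T where T: "T \<subseteq> S" "finite T" "card T = m" "\<forall>t\<in>T. \<forall>s\<in>S - T. (t, s) \<in> r"
    by (auto simp: least_elements_def)
  have "S - T \<noteq> {}" using assms(3) T(2) by (metis Diff_eq_empty_iff finite_subset)
  moreover have "S - T \<subseteq> \<Lambda>" using assms(2) by blast
  ultimately obtain u where u: "u \<in> S - T" "\<And>s. s \<in> S - T \<Longrightarrow> (u, s) \<in> r"
    using well_order_on_has_least[OF assms(1)] by blast
  have "least_elements r (Suc m) S (insert u T)"
    using T u by (auto simp: least_elements_def)
  then show ?case by blast
qed

text \<open>Two different finite sets of equal size each contain an element missing from the other.
  Each of these two elements would lie below the other one, against antisymmetry.\<close>

lemma least_elements_unique: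
  assumes "antisym r" "least_elements r m S T" "least_elements r m S T'"
  shows "T = T'"
proof (rule ccontr)
  assume ne: "T \<noteq> T'"
  note T = assms(2)[unfolded least_elements_def] and T' = assms(3)[unfolded least_elements_def]
  have "\<not> T \<subseteq> T'" "\<not> T' \<subseteq> T" using T T' ne by (metis card_subset_eq)+
  then obtain t t' where t: "t \<in> T - T'" "t' \<in> T' - T" by blast
  then have "(t, t') \<in> r" "(t', t) \<in> r" using T T' by blast+
  then show False using assms(1) t by (auto dest: antisymD)
qed

section \<open>Labelled digraphs and extended graphs\<close>

lemma act_ldigraph_id [simp]: "act_ldigraph id G = G"
  by (simp add: act_ldigraph_def map_prod.id)

lemma vlabel_act_ldigraph [simp]: "bij p \<Longrightarrow> vlabel (act_ldigraph p G) (p v) = vlabel G v"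
  by (simp add: act_ldigraph_def bij_is_inj)

lemma alabel_act_ldigraph [simp]:
  "bij p \<Longrightarrow> alabel (act_ldigraph p G) (p u, p v) = alabel G (u, v)"
  by (simp add: act_ldigraph_def bij_is_inj)

lemma arcs_act_ldigraph_iff [simp]:
  "bij p \<Longrightarrow> (p u, p v) \<in> arcs (act_ldigraph p G) \<longleftrightarrow> (u, v) \<in> arcs G"
  by (auto simp: act_ldigraph_def dest: bij_is_inj injD)

lemma act_ldigraph_closed:
  assumes p: "bij p" and G: "G \<in> ldigraphs_on V"
  shows "act_ldigraph p G \<in> ldigraphs_on (p ` V)"
proof -
  \<comment> \<open>The label maps are precomposed with \<open>inv p\<close>. Membership in an image
    is rewritten through \<open>inv p\<close> too, so that the equalities of domains can be checked
    point by point.\<close>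
  have v: "v \<in> p ` W \<longleftrightarrow> inv p v \<in> W" for v W
    using p by (metis bij_inv_eq_iff image_iff)
  have a: "(u, v) \<in> map_prod p p ` W \<longleftrightarrow> (inv p u, inv p v) \<in> W" for u v W
  proof
    assume "(inv p u, inv p v) \<in> W"
    moreover have "(u, v) = map_prod p p (inv p u, inv p v)"
      using p by (simp add: bij_is_surj surj_f_inv_f)
    ultimately show "(u, v) \<in> map_prod p p ` W" by (rule rev_image_eqI)
  next
    assume "(u, v) \<in> map_prod p p ` W"
    then show "(inv p u, inv p v) \<in> W" using p by (auto simp: bij_is_inj)
  qed
  have sub: "arcs G \<subseteq> V \<times> V" and dom: "dom (vlabel G) = V" "dom (alabel G) = arcs G"
    and verts: "verts G = V"
    using G by (auto simp: ldigraphs_on_def)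
  have "dom (vlabel G \<circ> inv p) = p ` V"
    unfolding set_eq_iff v by (simp add: domIff flip: dom(1))
  moreover have "dom (alabel G \<circ> map_prod (inv p) (inv p)) = map_prod p p ` arcs G"
    unfolding set_eq_iff split_paired_All a by (simp add: domIff flip: dom(2))
  ultimately show ?thesis using sub verts
    by (auto simp: ldigraphs_on_def act_ldigraph_def)
qed

text \<open>Labels need comparing only on vertices and arcs: the label maps are defined exactly
  there, so elsewhere both sides are \<open>None\<close>.\<close>

lemma act_ldigraph_eqI:
  assumes p: "bij p" and G: "G \<in> ldigraphs_on V" and G': "G' \<in> ldigraphs_on V'"
    and V: "p ` V = V'"
    and arcs: "map_prod p p ` arcs G = arcs G'"
    and vl: "\<And>v. v \<in> V \<Longrightarrow> vlabel G' (p v) = vlabel G v"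
    and al: "\<And>u v. (u, v) \<in> arcs G \<Longrightarrow> alabel G' (p u, p v) = alabel G (u, v)"
  shows "act_ldigraph p G = G'"
proof (rule ldigraph.equality)
  have cl: "act_ldigraph p G \<in> ldigraphs_on V'"
    using act_ldigraph_closed[OF p G] V by simp
  show "verts (act_ldigraph p G) = verts G'" using cl G' by (simp add: ldigraphs_on_def)
  show "arcs (act_ldigraph p G) = arcs G'" using arcs by (simp add: act_ldigraph_def)
  show "vlabel (act_ldigraph p G) = vlabel G'"
  proof
    fix v
    show "vlabel (act_ldigraph p G) v = vlabel G' v"
    proof (cases "v \<in> V'")
      case True
      then show ?thesis using V p vl by auto
    next
      case False
      then have "v \<notin> dom (vlabel (act_ldigraph p G))" "v \<notin> dom (vlabel G')"
        using cl G' by (simp_all only: ldigraphs_on_def mem_Collect_eq not_False_eq_True)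
      then show ?thesis by (simp add: domIff)
    qed
  qed
  show "alabel (act_ldigraph p G) = alabel G'"
  proof
    fix e
    show "alabel (act_ldigraph p G) e = alabel G' e"
    proof (cases "e \<in> arcs G'")
      case True
      then obtain u v where "e = (p u, p v)" "(u, v) \<in> arcs G" unfolding arcs[symmetric] by auto
      then show ?thesis using p al by simp
    next
      case False
      then have "e \<notin> arcs (act_ldigraph p G)"
        using arcs by (simp add: act_ldigraph_def)
      with False have "e \<notin> dom (alabel (act_ldigraph p G))" "e \<notin> dom (alabel G')"
        using cl G' by (simp_all only: ldigraphs_on_def mem_Collect_eq not_False_eq_True)
      then show ?thesis by (simp add: domIff)
    qed
  qed
qed simp

lemma act_ldigraph_plain:
  assumes g: "g permutes \<Omega>" and G: "G \<in> plain_ldigraphs \<Omega> hash circast"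
  shows "act_ldigraph g G \<in> plain_ldigraphs \<Omega> hash circast"
proof -
  have "act_ldigraph g G \<in> ldigraphs_on \<Omega>"
    using act_ldigraph_closed[OF permutes_bij[OF g], of G \<Omega>] G permutes_image[OF g]
    by (simp add: plain_ldigraphs_def)
  moreover have "ran (vlabel (act_ldigraph g G)) \<subseteq> ran (vlabel G)"
    "ran (alabel (act_ldigraph g G)) \<subseteq> ran (alabel G)"
    by (auto simp: act_ldigraph_def ran_def)
  ultimately show ?thesis using G unfolding plain_ldigraphs_def by blast
qed

lemma act_set_finite_ldigraph_sets:
  assumes "g permutes \<Omega>" "A \<in> finite_ldigraph_sets \<Omega> hash circast"
  shows "act_set act_ldigraph g A \<in> finite_ldigraph_sets \<Omega> hash circast"
  using assms act_ldigraph_plain by (fastforce simp: finite_ldigraph_sets_def act_set_def)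

lemma self_in_extended_graph_of: "G \<in> extended_graph_of \<Omega> G"
  unfolding extended_graph_of_def
  by (rule CollectI, rule exI[of _ id]) (simp add: permutes_id)

text \<open>Renaming by h keeps the vertex set, so both sides are orbits of the same group;
  multiplication by h and by \<open>inv h\<close> gives the two inclusions.\<close>

lemma extended_graph_of_act:
  assumes h: "h permutes (verts G - \<Omega>)"
  shows "extended_graph_of \<Omega> (act_ldigraph h G) = extended_graph_of \<Omega> G"
proof -
  have v: "verts (act_ldigraph h G) = verts G"
    using permutes_image[OF permutes_subset[OF h]] by (auto simp: act_ldigraph_def)
  have "act_ldigraph h' (act_ldigraph h G) \<in> extended_graph_of \<Omega> G"
    if "h' permutes (verts G - \<Omega>)" for h'
    unfolding extended_graph_of_def
    using permutes_compose[OF h that]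
      act_ldigraph_comp[OF permutes_bij[OF h] permutes_bij[OF that], of G]
    by (intro CollectI exI[of _ "h' \<circ> h"]) simp
  moreover have "act_ldigraph h' G \<in> extended_graph_of \<Omega> (act_ldigraph h G)"
    if h': "h' permutes (verts G - \<Omega>)" for h'
  proof -
    have "h' \<circ> inv h permutes (verts G - \<Omega>)"
      using permutes_compose[OF permutes_inv[OF h] h'] .
    moreover have "act_ldigraph (h' \<circ> inv h) (act_ldigraph h G) = act_ldigraph (h' \<circ> inv h \<circ> h) G"
      using act_ldigraph_comp[OF permutes_bij[OF h] permutes_bij[OF calculation], of G] by simp
    moreover have "h' \<circ> inv h \<circ> h = h'"
      using permutes_inv_o(2)[OF h] by (simp add: comp_assoc)
    ultimately show ?thesis
      unfolding extended_graph_of_def v by (intro CollectI exI[of _ "h' \<circ> inv h"]) simp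
  qed
  ultimately show ?thesis by (auto simp: extended_graph_of_def v)
qed

section \<open>The digraph underlying \<open>\<psi>\<close>\<close>

text \<open>Collects what the shape of the digraph depends on: the points of \<Omega>, the copies
  \<open>\<tau> i \<alpha>\<close> and the \<open>x i\<close> are pairwise distinct. Injectivity in
  the pair of i and \<alpha> combines disjointness of the parts with injectivity of each
  \<open>\<tau> i\<close>. It is what gives the definite descriptions in \<open>psi_ldigraph\<close>
  a unique witness.\<close>

locale psi_data =
  fixes \<Omega> :: "'a set" and hash circast :: 'l and k :: nat
    and \<Gamma> :: "nat \<Rightarrow> ('a, 'l) ldigraph" and \<tau> :: "nat \<Rightarrow> 'a \<Rightarrow> 'a" and x :: "nat \<Rightarrow> 'a"
  assumes tau_inj: "inj_on (\<lambda>(i, \<alpha>). \<tau> i \<alpha>) ({1..k} \<times> \<Omega>)"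
    and x_inj: "inj_on x {1..k}"
    and tau_notin: "\<lbrakk>i \<in> {1..k}; \<alpha> \<in> \<Omega>\<rbrakk> \<Longrightarrow> \<tau> i \<alpha> \<notin> \<Omega>"
    and x_notin: "i \<in> {1..k} \<Longrightarrow> x i \<notin> \<Omega>"
    and tau_neq_x: "\<lbrakk>i \<in> {1..k}; \<alpha> \<in> \<Omega>; j \<in> {1..k}\<rbrakk> \<Longrightarrow> \<tau> i \<alpha> \<noteq> x j"
    and plain: "i \<in> {1..k} \<Longrightarrow> \<Gamma> i \<in> plain_ldigraphs \<Omega> hash circast"
begin

abbreviation "D \<equiv> psi_ldigraph \<Omega> hash circast k \<Gamma> \<tau> x"

lemma tau_eq_iff:
  "\<lbrakk>i \<in> {1..k}; \<alpha> \<in> \<Omega>; j \<in> {1..k}; \<beta> \<in> \<Omega>\<rbrakk> \<Longrightarrow> \<tau> i \<alpha> = \<tau> j \<beta> \<longleftrightarrow> i = j \<and> \<alpha> = \<beta>"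
  using inj_onD[OF tau_inj, of "(i, \<alpha>)" "(j, \<beta>)"] by auto

lemma x_eq_iff: "\<lbrakk>i \<in> {1..k}; j \<in> {1..k}\<rbrakk> \<Longrightarrow> x i = x j \<longleftrightarrow> i = j"
  using x_inj by (auto dest: inj_onD)

lemma arcs_subset: "i \<in> {1..k} \<Longrightarrow> (\<alpha>, \<beta>) \<in> arcs (\<Gamma> i) \<Longrightarrow> \<alpha> \<in> \<Omega> \<and> \<beta> \<in> \<Omega>"
  using plain[of i] by (auto simp: plain_ldigraphs_def ldigraphs_on_def)

lemma verts_D: "verts D = \<Omega> \<union> (\<Union>i\<in>{1..k}. \<tau> i ` \<Omega>) \<union> x ` {1..k}"
  by (simp add: psi_ldigraph_def psi_verts_def)

lemma verts_cases [consumes 1, case_names base tau x]: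
  assumes "v \<in> verts D"
  obtains "v \<in> \<Omega>" | i \<alpha> where "i \<in> {1..k}" "\<alpha> \<in> \<Omega>" "v = \<tau> i \<alpha>" | i where "i \<in> {1..k}" "v = x i"
  using assms unfolding verts_D by blast

lemma arcs_D_iff:
  "(u, v) \<in> arcs D \<longleftrightarrow> (\<exists>i\<in>{1..k}. \<exists>\<alpha>\<in>\<Omega>. u = \<tau> i \<alpha> \<and>
     (v = \<alpha> \<or> v = x i \<or> (\<exists>\<beta>\<in>\<Omega>. v = \<tau> i \<beta> \<and> (\<alpha>, \<beta>) \<in> arcs (\<Gamma> i))))"
  (is "_ \<longleftrightarrow> ?R")
proof
  have D: "arcs D = psi_arcs \<Omega> k \<Gamma> \<tau> x" by (simp add: psi_ldigraph_def)
  show ?R if "(u, v) \<in> arcs D"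
    using that arcs_subset unfolding D psi_arcs_def by blast
  show "(u, v) \<in> arcs D" if ?R
    using that unfolding D psi_arcs_def by blast
qed

lemma arcs_cases [consumes 1, case_names base x tau]:
  assumes "(u, v) \<in> arcs D"
  obtains i \<alpha> where "i \<in> {1..k}" "\<alpha> \<in> \<Omega>" "u = \<tau> i \<alpha>" "v = \<alpha>"
  | i \<alpha> where "i \<in> {1..k}" "\<alpha> \<in> \<Omega>" "u = \<tau> i \<alpha>" "v = x i"
  | i \<alpha> \<beta> where "i \<in> {1..k}" "\<alpha> \<in> \<Omega>" "\<beta> \<in> \<Omega>" "u = \<tau> i \<alpha>" "v = \<tau> i \<beta>" "(\<alpha>, \<beta>) \<in> arcs (\<Gamma> i)"
  using assms unfolding arcs_D_iff by blast

lemma arc_base: "i \<in> {1..k} \<Longrightarrow> \<alpha> \<in> \<Omega> \<Longrightarrow> (\<tau> i \<alpha>, \<alpha>) \<in> arcs D"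
  and arc_x: "i \<in> {1..k} \<Longrightarrow> \<alpha> \<in> \<Omega> \<Longrightarrow> (\<tau> i \<alpha>, x i) \<in> arcs D"
  by (auto simp: arcs_D_iff)

text \<open>The other arcs end in \<Omega> or in X, never at a copy, and an arc between copies
  determines its index and its two endpoints in \<Omega>.\<close>

lemma arc_tau_iff:
  assumes "i \<in> {1..k}" "\<alpha> \<in> \<Omega>" "\<beta> \<in> \<Omega>"
  shows "(\<tau> i \<alpha>, \<tau> i \<beta>) \<in> arcs D \<longleftrightarrow> (\<alpha>, \<beta>) \<in> arcs (\<Gamma> i)"
proof
  assume "(\<tau> i \<alpha>, \<tau> i \<beta>) \<in> arcs D"
  then show "(\<alpha>, \<beta>) \<in> arcs (\<Gamma> i)"
    by (cases rule: arcs_cases) (use assms tau_eq_iff tau_notin tau_neq_x in metis)+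
qed (use assms in \<open>unfold arcs_D_iff, blast\<close>)

lemma vlabel_base: "\<alpha> \<in> \<Omega> \<Longrightarrow> vlabel D \<alpha> = Some hash"
  by (simp add: psi_ldigraph_def psi_verts_def)

lemma vlabel_x: "i \<in> {1..k} \<Longrightarrow> vlabel D (x i) = Some circast"
  using x_notin by (auto simp: psi_ldigraph_def psi_verts_def)

lemma vlabel_tau:
  assumes "i \<in> {1..k}" "\<alpha> \<in> \<Omega>"
  shows "vlabel D (\<tau> i \<alpha>) = vlabel (\<Gamma> i) \<alpha>"
proof -
  have "(THE l. \<exists>j\<in>{1..k}. \<exists>\<beta>\<in>\<Omega>. \<tau> i \<alpha> = \<tau> j \<beta> \<and> l = vlabel (\<Gamma> j) \<beta>) = vlabel (\<Gamma> i) \<alpha>"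
  proof (rule the_equality)
    show "\<exists>j\<in>{1..k}. \<exists>\<beta>\<in>\<Omega>. \<tau> i \<alpha> = \<tau> j \<beta> \<and> vlabel (\<Gamma> i) \<alpha> = vlabel (\<Gamma> j) \<beta>"
      using assms by blast
  next
    fix l
    assume "\<exists>j\<in>{1..k}. \<exists>\<beta>\<in>\<Omega>. \<tau> i \<alpha> = \<tau> j \<beta> \<and> l = vlabel (\<Gamma> j) \<beta>"
    then obtain j \<beta> where "j \<in> {1..k}" "\<beta> \<in> \<Omega>" "\<tau> i \<alpha> = \<tau> j \<beta>" "l = vlabel (\<Gamma> j) \<beta>" by blast
    then show "l = vlabel (\<Gamma> i) \<alpha>" using tau_eq_iff[OF assms] by blast
  qed
  moreover have "\<tau> i \<alpha> \<in> psi_verts \<Omega> k \<tau> x" "\<tau> i \<alpha> \<notin> x ` {1..k}"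
    using assms tau_neq_x[OF assms] unfolding psi_verts_def by blast+
  ultimately show ?thesis
    using tau_notin[OF assms] by (simp add: psi_ldigraph_def)
qed

lemma alabel_base: "i \<in> {1..k} \<Longrightarrow> \<alpha> \<in> \<Omega> \<Longrightarrow> alabel D (\<tau> i \<alpha>, \<alpha>) = Some hash"
  using arc_base by (simp add: psi_ldigraph_def)

lemma alabel_x: "i \<in> {1..k} \<Longrightarrow> \<alpha> \<in> \<Omega> \<Longrightarrow> alabel D (\<tau> i \<alpha>, x i) = Some circast"
  using arc_x[of i \<alpha>] x_notin[of i] by (simp add: psi_ldigraph_def)

text \<open>Covers non-arcs as well, where both sides are \<open>None\<close>. Equality of the
  values of \<open>alabel\<close> thus also records which arcs are present.\<close>

lemma alabel_tau:
  assumes "i \<in> {1..k}" "\<alpha> \<in> \<Omega>" "\<beta> \<in> \<Omega>"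
  shows "alabel D (\<tau> i \<alpha>, \<tau> i \<beta>) = alabel (\<Gamma> i) (\<alpha>, \<beta>)"
proof (cases "(\<alpha>, \<beta>) \<in> arcs (\<Gamma> i)")
  case True
  have "(THE l. \<exists>j\<in>{1..k}. \<exists>\<alpha>' \<beta>'. (\<alpha>', \<beta>') \<in> arcs (\<Gamma> j) \<and> (\<tau> i \<alpha>, \<tau> i \<beta>) = (\<tau> j \<alpha>', \<tau> j \<beta>') \<and>
           l = alabel (\<Gamma> j) (\<alpha>', \<beta>')) = alabel (\<Gamma> i) (\<alpha>, \<beta>)"
  proof (rule the_equality)
    show "\<exists>j\<in>{1..k}. \<exists>\<alpha>' \<beta>'. (\<alpha>', \<beta>') \<in> arcs (\<Gamma> j) \<and> (\<tau> i \<alpha>, \<tau> i \<beta>) = (\<tau> j \<alpha>', \<tau> j \<beta>') \<and>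
           alabel (\<Gamma> i) (\<alpha>, \<beta>) = alabel (\<Gamma> j) (\<alpha>', \<beta>')"
      using assms True by blast
  next
    fix l
    assume "\<exists>j\<in>{1..k}. \<exists>\<alpha>' \<beta>'. (\<alpha>', \<beta>') \<in> arcs (\<Gamma> j) \<and> (\<tau> i \<alpha>, \<tau> i \<beta>) = (\<tau> j \<alpha>', \<tau> j \<beta>') \<and>
           l = alabel (\<Gamma> j) (\<alpha>', \<beta>')"
    then obtain j \<alpha>' \<beta>' where j: "j \<in> {1..k}" "(\<alpha>', \<beta>') \<in> arcs (\<Gamma> j)"
      "\<tau> i \<alpha> = \<tau> j \<alpha>'" "\<tau> i \<beta> = \<tau> j \<beta>'" "l = alabel (\<Gamma> j) (\<alpha>', \<beta>')" by blast
    with arcs_subset[OF j(1,2)] show "l = alabel (\<Gamma> i) (\<alpha>, \<beta>)"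
      using tau_eq_iff assms by metis
  qed
  moreover have "(\<tau> i \<alpha>, \<tau> i \<beta>) \<in> psi_arcs \<Omega> k \<Gamma> \<tau> x"
    using arc_tau_iff[OF assms] True by (simp add: psi_ldigraph_def)
  moreover have "\<tau> i \<beta> \<notin> \<Omega>" "\<tau> i \<beta> \<notin> x ` {1..k}"
    using tau_notin tau_neq_x assms by blast+
  ultimately show ?thesis by (simp add: psi_ldigraph_def)
next
  case False
  then have "alabel (\<Gamma> i) (\<alpha>, \<beta>) = None"
    using plain[OF assms(1)] by (auto simp: plain_ldigraphs_def ldigraphs_on_def dom_def)
  moreover have "(\<tau> i \<alpha>, \<tau> i \<beta>) \<notin> psi_arcs \<Omega> k \<Gamma> \<tau> x"
    using arc_tau_iff[OF assms] False by (simp add: psi_ldigraph_def)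
  ultimately show ?thesis by (simp add: psi_ldigraph_def)
qed

lemma D_ldigraph: "D \<in> ldigraphs_on (verts D)"
proof -
  have labels: "vlabel (\<Gamma> i) \<alpha> \<noteq> None" "(\<alpha>, \<beta>) \<in> arcs (\<Gamma> i) \<Longrightarrow> alabel (\<Gamma> i) (\<alpha>, \<beta>) \<noteq> None"
    if "i \<in> {1..k}" "\<alpha> \<in> \<Omega>" for i \<alpha> \<beta>
    using plain[OF that(1)] that(2) by (auto simp: plain_ldigraphs_def ldigraphs_on_def)
  have "(u, v) \<in> verts D \<times> verts D" if "(u, v) \<in> arcs D" for u v
    using that by (cases rule: arcs_cases) (auto simp: verts_D)
  then have "arcs D \<subseteq> verts D \<times> verts D" by (rule subrelI)
  moreover have "vlabel D v \<noteq> None" if "v \<in> verts D" for v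
    using that by (cases rule: verts_cases) (simp_all add: vlabel_base vlabel_x vlabel_tau labels)
  then have "dom (vlabel D) = verts D"
    by (auto simp: domIff) (simp add: psi_ldigraph_def split: if_splits)
  moreover have "alabel D (u, v) \<noteq> None" if "(u, v) \<in> arcs D" for u v
    using that
    by (cases rule: arcs_cases) (simp_all add: alabel_base alabel_x alabel_tau labels)
  then have "dom (alabel D) = arcs D"
    by (auto simp: domIff) (simp add: psi_ldigraph_def split: if_splits)
  ultimately show ?thesis
    by (simp add: ldigraphs_on_def)
qed

end

section \<open>Isomorphisms between digraphs built from different data\<close>

text \<open>The parameters \<pi> and g serve two uses. With g the identity, p fixes \<Omega>
  pointwise and compares two choices for the same set; with \<pi> the identity and p equal to g, it
  compares a choice for a set with one for its translate.\<close>

lemma act_psi_ldigraph: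
  assumes "psi_data \<Omega> hash circast k \<Gamma> \<tau> x" and "psi_data \<Omega> hash circast k \<Gamma>' \<tau>' x'"
    and p: "bij p" and g: "g permutes \<Omega>" and \<pi>: "bij_betw \<pi> {1..k} {1..k}"
    and p_base: "\<And>\<alpha>. \<alpha> \<in> \<Omega> \<Longrightarrow> p \<alpha> = g \<alpha>"
    and p_tau: "\<And>i \<alpha>. i \<in> {1..k} \<Longrightarrow> \<alpha> \<in> \<Omega> \<Longrightarrow> p (\<tau> i \<alpha>) = \<tau>' (\<pi> i) (g \<alpha>)"
    and p_x: "\<And>i. i \<in> {1..k} \<Longrightarrow> p (x i) = x' (\<pi> i)"
    and \<Gamma>': "\<And>i. i \<in> {1..k} \<Longrightarrow> \<Gamma>' (\<pi> i) = act_ldigraph g (\<Gamma> i)"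
  shows "act_ldigraph p (psi_ldigraph \<Omega> hash circast k \<Gamma> \<tau> x) =
    psi_ldigraph \<Omega> hash circast k \<Gamma>' \<tau>' x'"
proof -
  interpret P: psi_data \<Omega> hash circast k \<Gamma> \<tau> x by fact
  interpret Q: psi_data \<Omega> hash circast k \<Gamma>' \<tau>' x' by fact
  have gO: "g \<alpha> \<in> \<Omega> \<longleftrightarrow> \<alpha> \<in> \<Omega>" for \<alpha> using permutes_in_image[OF g] .
  have pi: "\<pi> i \<in> {1..k}" if "i \<in> {1..k}" for i using \<pi> that bij_betwE by blast
  have pi_surj: "\<exists>i\<in>{1..k}. j = \<pi> i" if "j \<in> {1..k}" for j
    using \<pi> that by (auto simp: bij_betw_def)
  have g_surj: "\<exists>\<alpha>\<in>\<Omega>. \<beta> = g \<alpha>" if "\<beta> \<in> \<Omega>" for \<beta>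
    using permutes_image[OF g] that by blast
  note bg = permutes_bij[OF g]
  show ?thesis
  proof (rule act_ldigraph_eqI[OF p P.D_ldigraph Q.D_ldigraph])
    show "p ` verts P.D = verts Q.D"
    proof (intro equalityI subsetI)
      fix v assume "v \<in> p ` verts P.D"
      then obtain u where u: "u \<in> verts P.D" "v = p u" by blast
      from u(1) show "v \<in> verts Q.D"
      proof (cases rule: P.verts_cases)
        case base
        then show ?thesis using u(2) p_base gO by (simp add: Q.verts_D)
      next
        case (tau i \<alpha>)
        then have "v = \<tau>' (\<pi> i) (g \<alpha>)" "\<pi> i \<in> {1..k}" "g \<alpha> \<in> \<Omega>" using u(2) p_tau pi gO by auto
        then show ?thesis unfolding Q.verts_D by blast
      next
        case (x i)
        then have "v = x' (\<pi> i)" "\<pi> i \<in> {1..k}" using u(2) p_x pi by auto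
        then show ?thesis unfolding Q.verts_D by blast
      qed
    next
      fix v assume "v \<in> verts Q.D"
      then show "v \<in> p ` verts P.D"
      proof (cases rule: Q.verts_cases)
        case base
        then show ?thesis using g_surj[of v] p_base by (force simp: P.verts_D)
      next
        case (tau j \<beta>)
        then obtain i \<alpha> where "i \<in> {1..k}" "\<alpha> \<in> \<Omega>" "v = p (\<tau> i \<alpha>)"
          using pi_surj g_surj p_tau by metis
        then show ?thesis unfolding P.verts_D by blast
      next
        case (x j)
        then obtain i where "i \<in> {1..k}" "v = p (x i)"
          using pi_surj p_x by metis
        then show ?thesis unfolding P.verts_D by blast
      qed
    qed
    show "map_prod p p ` arcs P.D = arcs Q.D"
    proof (intro equalityI subrelI)
      fix u' v' assume "(u', v') \<in> map_prod p p ` arcs P.D"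
      then obtain u v where uv: "(u, v) \<in> arcs P.D" "u' = p u" "v' = p v" by auto
      from uv(1) show "(u', v') \<in> arcs Q.D"
      proof (cases rule: P.arcs_cases)
        case (base i \<alpha>)
        then show ?thesis using uv Q.arc_base[of "\<pi> i" "g \<alpha>"] pi gO p_tau p_base by simp
      next
        case (x i \<alpha>)
        then show ?thesis using uv Q.arc_x[of "\<pi> i" "g \<alpha>"] pi gO p_tau p_x by simp
      next
        case (tau i \<alpha> \<beta>)
        then show ?thesis
          using uv Q.arc_tau_iff[of "\<pi> i" "g \<alpha>" "g \<beta>"] pi gO p_tau \<Gamma>' bg by simp
      qed
    next
      fix u' v' assume "(u', v') \<in> arcs Q.D"
      \<comment> \<open>Every index is a value of \<pi> and every point of \<Omega> a value of g, so
        an arc pulls back to one of the same kind.\<close>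
      then have "\<exists>u v. (u, v) \<in> arcs P.D \<and> u' = p u \<and> v' = p v"
      proof (cases rule: Q.arcs_cases)
        case (base j \<beta>)
        then obtain i \<alpha> where "i \<in> {1..k}" "\<alpha> \<in> \<Omega>" "j = \<pi> i" "\<beta> = g \<alpha>"
          using pi_surj g_surj by metis
        then show ?thesis using base P.arc_base p_tau p_base by metis
      next
        case (x j \<beta>)
        then obtain i \<alpha> where "i \<in> {1..k}" "\<alpha> \<in> \<Omega>" "j = \<pi> i" "\<beta> = g \<alpha>"
          using pi_surj g_surj by metis
        then show ?thesis using x P.arc_x p_tau p_x by metis
      next
        case (tau j \<beta> \<beta>')
        then obtain i \<alpha> \<alpha>' where *: "i \<in> {1..k}" "\<alpha> \<in> \<Omega>" "\<alpha>' \<in> \<Omega>" "j = \<pi> i" "\<beta> = g \<alpha>" "\<beta>' = g \<alpha>'"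
          using pi_surj g_surj by metis
        then have "(\<alpha>, \<alpha>') \<in> arcs (\<Gamma> i)" using tau \<Gamma>' bg by simp
        then show ?thesis using tau * P.arc_tau_iff p_tau by metis
      qed
      then show "(u', v') \<in> map_prod p p ` arcs P.D" by auto
    qed
  next
    fix v assume "v \<in> verts P.D"
    then show "vlabel Q.D (p v) = vlabel P.D v"
    proof (cases rule: P.verts_cases)
      case base
      then show ?thesis using p_base gO by (simp add: P.vlabel_base Q.vlabel_base)
    next
      case (tau i \<alpha>)
      then show ?thesis using p_tau pi gO \<Gamma>' bg by (simp add: P.vlabel_tau Q.vlabel_tau)
    next
      case (x i)
      then show ?thesis using p_x pi by (simp add: P.vlabel_x Q.vlabel_x)
    qed
  next
    fix u v assume "(u, v) \<in> arcs P.D"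
    then show "alabel Q.D (p u, p v) = alabel P.D (u, v)"
    proof (cases rule: P.arcs_cases)
      case (base i \<alpha>)
      then show ?thesis using P.alabel_base[of i \<alpha>] Q.alabel_base[of "\<pi> i" "g \<alpha>"] p_tau p_base pi gO
        by simp
    next
      case (x i \<alpha>)
      then show ?thesis using P.alabel_x[of i \<alpha>] Q.alabel_x[of "\<pi> i" "g \<alpha>"] p_tau p_x pi gO
        by simp
    next
      case (tau i \<alpha> \<beta>)
      then show ?thesis
        using P.alabel_tau[of i \<alpha> \<beta>] Q.alabel_tau[of "\<pi> i" "g \<alpha>" "g \<beta>"] p_tau pi gO \<Gamma>' bg
        by simp
    qed
  qed
qed

section \<open>Recovering the digraphs\<close>

text \<open>Here \<open>y\<close> stands for some \<open>x i\<close> and \<open>t\<close> for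
  \<open>\<tau> i\<close>, but no index occurs: the property speaks of D alone. Arcs of G are not
  compared separately, since they form the domain of \<open>alabel G\<close>.\<close>

definition encodes :: "'a set \<Rightarrow> 'l \<Rightarrow> ('a, 'l) ldigraph \<Rightarrow> ('a, 'l) ldigraph \<Rightarrow> bool" where
  "encodes \<Omega> circast D G \<longleftrightarrow> G \<in> ldigraphs_on \<Omega> \<and>
     (\<exists>y t. vlabel D y = Some circast \<and>
       (\<forall>\<alpha>\<in>\<Omega>. (t \<alpha>, y) \<in> arcs D \<and> (t \<alpha>, \<alpha>) \<in> arcs D \<and> vlabel D (t \<alpha>) = vlabel G \<alpha>) \<and>
       (\<forall>\<alpha>\<in>\<Omega>. \<forall>\<beta>\<in>\<Omega>. alabel D (t \<alpha>, t \<beta>) = alabel G (\<alpha>, \<beta>)))"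

text \<open>The witnesses \<open>y\<close> and \<open>t\<close> are moved along by h. That h fixes
  \<Omega> pointwise enters through the arcs from \<open>t \<alpha>\<close> to \<alpha>, whose
  targets must stay in place.\<close>

lemma encodes_act:
  assumes h: "bij h" "\<And>\<alpha>. \<alpha> \<in> \<Omega> \<Longrightarrow> h \<alpha> = \<alpha>" and "encodes \<Omega> circast D G"
  shows "encodes \<Omega> circast (act_ldigraph h D) G"
proof -
  obtain y t where *: "vlabel D y = Some circast"
    "\<And>\<alpha>. \<alpha> \<in> \<Omega> \<Longrightarrow> (t \<alpha>, y) \<in> arcs D \<and> (t \<alpha>, \<alpha>) \<in> arcs D \<and> vlabel D (t \<alpha>) = vlabel G \<alpha>"
    "\<And>\<alpha> \<beta>. \<alpha> \<in> \<Omega> \<Longrightarrow> \<beta> \<in> \<Omega> \<Longrightarrow> alabel D (t \<alpha>, t \<beta>) = alabel G (\<alpha>, \<beta>)" "G \<in> ldigraphs_on \<Omega>"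
    using assms(3) unfolding encodes_def by blast
  have base: "(h (t \<alpha>), \<alpha>) \<in> arcs (act_ldigraph h D)" if "\<alpha> \<in> \<Omega>" for \<alpha>
    using *(2)[OF that] arcs_act_ldigraph_iff[OF h(1), of "t \<alpha>" \<alpha> D] h(2)[OF that] by simp
  then show ?thesis unfolding encodes_def
    by (intro conjI exI[of _ "h y"] exI[of _ "h \<circ> t"] ballI) (simp_all add: * h(1) base)
qed

lemma ldigraphs_on_eqI:
  assumes "G \<in> ldigraphs_on V" "H \<in> ldigraphs_on V"
    and "\<And>v. v \<in> V \<Longrightarrow> vlabel G v = vlabel H v"
    and "\<And>u v. u \<in> V \<Longrightarrow> v \<in> V \<Longrightarrow> alabel G (u, v) = alabel H (u, v)"
  shows "G = H"
proof (rule ldigraph.equality)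
  have G: "verts G = V" "dom (vlabel G) = V" "arcs G \<subseteq> V \<times> V" "dom (alabel G) = arcs G"
    and H: "verts H = V" "dom (vlabel H) = V" "arcs H \<subseteq> V \<times> V" "dom (alabel H) = arcs H"
    using assms(1,2) by (auto simp: ldigraphs_on_def)
  show "verts G = verts H" using G H by simp
  show "vlabel G = vlabel H" using G H assms(3) by (metis domIff ext)
  show al: "alabel G = alabel H"
  proof
    fix e :: "'a \<times> 'a"
    show "alabel G e = alabel H e"
    proof (cases "e \<in> V \<times> V")
      case True
      then show ?thesis using assms(4) by auto
    next
      case False
      then have "e \<notin> dom (alabel G)" "e \<notin> dom (alabel H)" using G H by auto
      then show ?thesis by (simp add: domIff)
    qed
  qed
  show "arcs G = arcs H" using G(4) H(4) al by simp
qed simp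

text \<open>From right to left, \<open>x i\<close> and \<open>\<tau> i\<close> are witnesses.
  Conversely the labels force \<open>y\<close> to be some \<open>x i\<close>, and the two arcs out
  of each \<open>t \<alpha>\<close> force \<open>t\<close> to agree with \<open>\<tau> i\<close> on
  \<Omega>.\<close>

lemma (in psi_data) encodes_D_iff:
  assumes "\<Omega> \<noteq> {}" "hash \<noteq> circast"
  shows "encodes \<Omega> circast D G \<longleftrightarrow> G \<in> \<Gamma> ` {1..k}"
proof
  assume "G \<in> \<Gamma> ` {1..k}"
  then obtain i where i: "i \<in> {1..k}" "G = \<Gamma> i" by blast
  then have "G \<in> ldigraphs_on \<Omega>" using plain by (simp add: plain_ldigraphs_def)
  then show "encodes \<Omega> circast D G"
    unfolding encodes_def
    using i vlabel_x arc_x arc_base vlabel_tau alabel_tau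
    by (intro conjI exI[of _ "x i"] exI[of _ "\<tau> i"]) auto
next
  assume "encodes \<Omega> circast D G"
  then obtain y t where *: "vlabel D y = Some circast"
    "\<And>\<alpha>. \<alpha> \<in> \<Omega> \<Longrightarrow> (t \<alpha>, y) \<in> arcs D \<and> (t \<alpha>, \<alpha>) \<in> arcs D \<and> vlabel D (t \<alpha>) = vlabel G \<alpha>"
    "\<And>\<alpha> \<beta>. \<alpha> \<in> \<Omega> \<Longrightarrow> \<beta> \<in> \<Omega> \<Longrightarrow> alabel D (t \<alpha>, t \<beta>) = alabel G (\<alpha>, \<beta>)" "G \<in> ldigraphs_on \<Omega>"
    unfolding encodes_def by blast
  have "y \<in> verts D" using *(1) D_ldigraph by (auto simp: ldigraphs_on_def)
  \<comment> \<open>A point of \<Omega> has label \<open>hash\<close>, and a copy has a label from a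
    plain digraph; neither can be \<open>circast\<close>.\<close>
  then obtain i where i: "i \<in> {1..k}" "y = x i"
  proof (cases rule: verts_cases)
    case base
    then show ?thesis using *(1) vlabel_base assms(2) by simp
  next
    case (tau j \<alpha>)
    then have "circast \<in> ran (vlabel (\<Gamma> j))"
      using *(1) vlabel_tau by (simp add: ranI)
    then show ?thesis using plain[OF tau(1)] by (auto simp: plain_ldigraphs_def)
  qed (use that in blast)
  \<comment> \<open>The arc to \<open>x i\<close> determines the copy, the arc to \<alpha>
    determines the point that is copied; joint injectivity merges the two descriptions.\<close>
  have t: "t \<alpha> = \<tau> i \<alpha>" if \<alpha>: "\<alpha> \<in> \<Omega>" for \<alpha>
  proof -
    have "(t \<alpha>, x i) \<in> arcs D" "(t \<alpha>, \<alpha>) \<in> arcs D" using *(2)[OF \<alpha>] i by simp_all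
    from this(1) obtain \<beta> where \<beta>: "\<beta> \<in> \<Omega>" "t \<alpha> = \<tau> i \<beta>"
      by (cases rule: arcs_cases) (use i x_notin x_eq_iff tau_neq_x in metis)+
    from \<open>(t \<alpha>, \<alpha>) \<in> arcs D\<close> obtain j where "j \<in> {1..k}" "t \<alpha> = \<tau> j \<alpha>"
      by (cases rule: arcs_cases) (use \<alpha> x_notin tau_notin in blast)+
    then show ?thesis using \<beta> tau_eq_iff i \<alpha> by metis
  qed
  have "G = \<Gamma> i"
  proof (rule ldigraphs_on_eqI[OF *(4)])
    show "\<Gamma> i \<in> ldigraphs_on \<Omega>" using plain[OF i(1)] by (simp add: plain_ldigraphs_def)
  qed (use *(2,3) t vlabel_tau alabel_tau i(1) in simp_all)
  then show "G \<in> \<Gamma> ` {1..k}" using i(1) by blast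
qed

section \<open>Admissible choices\<close>

lemma psi_choiceD:
  assumes "psi_choice \<Omega> \<Lambda> r A k \<Gamma> V \<tau> x"
  shows "bij_betw \<Gamma> {1..k} A"
    and "disjoint_family_on V {1..k}"
    and "least_elements r (k * card \<Omega>) (\<Lambda> - \<Omega>) (\<Union>i\<in>{1..k}. V i)"
    and "\<And>i. i \<in> {1..k} \<Longrightarrow> bij_betw (\<tau> i) \<Omega> (V i)"
    and "inj_on x {1..k}"
    and "least_elements r k (\<Lambda> - (\<Omega> \<union> (\<Union>i\<in>{1..k}. V i))) (x ` {1..k})"
    and "(\<Union>i\<in>{1..k}. \<tau> i ` \<Omega>) = (\<Union>i\<in>{1..k}. V i)"
  using assms by (simp_all add: psi_choice_def bij_betw_def)

lemma psi_choice_psi_data: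
  assumes c: "psi_choice \<Omega> \<Lambda> r A k \<Gamma> V \<tau> x" and A: "A \<subseteq> plain_ldigraphs \<Omega> hash circast"
  shows "psi_data \<Omega> hash circast k \<Gamma> \<tau> x"
proof -
  note d = psi_choiceD[OF c]
  have subV: "V i \<subseteq> \<Lambda> - \<Omega>" if "i \<in> {1..k}" for i
    using least_elements_subset[OF d(3)] that by blast
  have subX: "x ` {1..k} \<subseteq> \<Lambda> - (\<Omega> \<union> (\<Union>i\<in>{1..k}. V i))"
    using least_elements_subset[OF d(6)] .
  have tau: "\<tau> i ` \<Omega> = V i" "inj_on (\<tau> i) \<Omega>" if "i \<in> {1..k}" for i
    using d(4)[OF that] by (simp_all add: bij_betw_def)
  show ?thesis
  proof
    show "inj_on (\<lambda>(i, \<alpha>). \<tau> i \<alpha>) ({1..k} \<times> \<Omega>)"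
    proof (rule inj_onI, clarify)
      fix i \<alpha> j \<beta>
      assume *: "i \<in> {1..k}" "\<alpha> \<in> \<Omega>" "j \<in> {1..k}" "\<beta> \<in> \<Omega>" "\<tau> i \<alpha> = \<tau> j \<beta>"
      then have "\<tau> i \<alpha> \<in> V i" "\<tau> i \<alpha> \<in> V j" using tau(1) by blast+
      then have "i = j" using d(2) *(1,3) unfolding disjoint_family_on_def by blast
      then show "i = j \<and> \<alpha> = \<beta>" using inj_onD[OF tau(2)[OF *(1)]] * by simp
    qed
    show "inj_on x {1..k}" by (rule d(5))
    show "\<tau> i \<alpha> \<notin> \<Omega>" if "i \<in> {1..k}" "\<alpha> \<in> \<Omega>" for i \<alpha>
      using tau(1)[OF that(1)] subV[OF that(1)] that(2) by blast
    show "x i \<notin> \<Omega>" if "i \<in> {1..k}" for i using subX that by blast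
    show "\<tau> i \<alpha> \<noteq> x j" if "i \<in> {1..k}" "\<alpha> \<in> \<Omega>" "j \<in> {1..k}" for i \<alpha> j
    proof -
      have "\<tau> i \<alpha> \<in> V i" "x j \<notin> V i" using tau(1)[OF that(1)] subX that by blast+
      then show ?thesis by metis
    qed
    show "\<Gamma> i \<in> plain_ldigraphs \<Omega> hash circast" if "i \<in> {1..k}" for i
      using bij_betwE[OF d(1)] A that by blast
  qed
qed

text \<open>A single bijection f from pairs (index, point of \<Omega>) onto the least elements
  supplies all \<open>\<tau> i\<close> at once, and the parts \<open>V i\<close> are their images.
  Removing a finite set keeps \<Lambda> infinite, so least elements exist at both stages.\<close>

lemma psi_choice_exists:
  assumes fin: "finite \<Omega>" and "infinite \<Lambda>" and wo: "well_order_on \<Lambda> r" and "finite A"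
  shows "\<exists>k \<Gamma> V \<tau> x. psi_choice \<Omega> \<Lambda> r A k \<Gamma> V \<tau> x"
proof -
  define k where "k = card A"
  obtain \<Gamma> where \<Gamma>: "bij_betw \<Gamma> {1..k} A"
    using finite_same_card_bij[of "{1..k}" A] assms(4) by (auto simp: k_def)
  obtain T where T: "least_elements r (k * card \<Omega>) (\<Lambda> - \<Omega>) T"
    using least_elements_exist[OF wo, of "\<Lambda> - \<Omega>"] assms(1,2) by (metis Diff_infinite_finite Diff_subset)
  then have T': "finite T" "card T = k * card \<Omega>" by (simp_all add: least_elements_def)
  obtain f where f: "bij_betw f ({1..k} \<times> \<Omega>) T"
    using finite_same_card_bij[of "{1..k} \<times> \<Omega>" T] fin T' by auto
  define \<tau> where "\<tau> i \<alpha> = f (i, \<alpha>)" for i \<alpha>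
  define V where "V i = \<tau> i ` \<Omega>" for i
  have VT: "(\<Union>i\<in>{1..k}. V i) = T"
    using f by (auto simp: V_def \<tau>_def bij_betw_def)
  have f_eq: "i = j \<and> \<alpha> = \<beta>" if "i \<in> {1..k}" "\<alpha> \<in> \<Omega>" "j \<in> {1..k}" "\<beta> \<in> \<Omega>" "f (i, \<alpha>) = f (j, \<beta>)"
    for i j \<alpha> \<beta>
    using bij_betw_imp_inj_on[OF f] that by (auto dest: inj_onD)
  have \<tau>: "bij_betw (\<tau> i) \<Omega> (V i)" if "i \<in> {1..k}" for i
    unfolding bij_betw_def V_def \<tau>_def using f_eq that by (auto intro!: inj_onI)
  have "disjoint_family_on V {1..k}"
    using f_eq unfolding disjoint_family_on_def V_def \<tau>_def by blast
  moreover have "card (V i) = card \<Omega>" if "i \<in> {1..k}" for i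
    using bij_betw_same_card[OF \<tau>[OF that]] by simp
  moreover obtain X where X: "least_elements r k (\<Lambda> - (\<Omega> \<union> T)) X"
    using least_elements_exist[OF wo, of "\<Lambda> - (\<Omega> \<union> T)"] assms(1,2) T'(1)
    by (metis Diff_infinite_finite Diff_subset finite_UnI)
  moreover obtain x where "bij_betw x {1..k} X"
    using finite_same_card_bij[of "{1..k}" X] X by (auto simp: least_elements_def)
  ultimately have "psi_choice \<Omega> \<Lambda> r A k \<Gamma> V \<tau> x"
    unfolding psi_choice_def VT using \<Gamma> T \<tau> by (simp add: bij_betw_def)
  then show ?thesis by blast
qed

section \<open>Independence of the choices\<close>

text \<open>Needed twice: for the copies, indexed by pairs, and for the elements of X.\<close>

lemma permutes_reindex:
  assumes "inj_on c I" "inj_on c' I" "c ` I = c' ` I"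
  obtains p where "p permutes c ` I" "\<And>i. i \<in> I \<Longrightarrow> p (c i) = c' i"
proof
  define p where "p v = (if v \<in> c ` I then c' (inv_into I c v) else v)" for v
  show pc: "p (c i) = c' i" if "i \<in> I" for i
    using assms(1) that by (simp add: p_def)
  have "p ` c ` I = c ` I"
    unfolding image_image using pc assms(3) by simp
  moreover have "inj_on p (c ` I)"
    using pc assms(2) by (auto intro!: inj_onI dest: inj_onD)
  ultimately show "p permutes c ` I"
    by (intro bij_imp_permutes) (auto simp: bij_betw_def p_def)
qed

text \<open>The copies and X are the same sets in both choices, so the data differ by a permutation
  fixing \<Omega> pointwise, and this stays within one orbit.\<close>

lemma psi_choice_unique:
  assumes c: "psi_choice \<Omega> \<Lambda> r A k \<Gamma> V \<tau> x" and c': "psi_choice \<Omega> \<Lambda> r A k' \<Gamma>' V' \<tau>' x'"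
    and A: "A \<subseteq> plain_ldigraphs \<Omega> hash circast" and wo: "well_order_on \<Lambda> r"
  shows "extended_graph_of \<Omega> (psi_ldigraph \<Omega> hash circast k \<Gamma> \<tau> x) =
    extended_graph_of \<Omega> (psi_ldigraph \<Omega> hash circast k' \<Gamma>' \<tau>' x')"
proof -
  note d = psi_choiceD[OF c]
  have anti: "antisym r"
    using wo by (simp add: well_order_on_def linear_order_on_def partial_order_on_def)
  have k': "k' = k"
    using bij_betw_same_card[OF d(1)] bij_betw_same_card[OF psi_choiceD(1)[OF c']] by simp
  note c' = c'[unfolded k']
  note d' = psi_choiceD[OF c']
  interpret P: psi_data \<Omega> hash circast k \<Gamma> \<tau> x using c A by (rule psi_choice_psi_data)
  interpret Q: psi_data \<Omega> hash circast k \<Gamma>' \<tau>' x' using c' A by (rule psi_choice_psi_data)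
  have VV: "(\<Union>i\<in>{1..k}. V i) = (\<Union>i\<in>{1..k}. V' i)"
    using least_elements_unique[OF anti d(3) d'(3)] .
  \<comment> \<open>X is taken from the complement of the copies, so the two versions become
    comparable only through \<open>VV\<close>.\<close>
  have XX: "x ` {1..k} = x' ` {1..k}"
    using least_elements_unique[OF anti d(6)[unfolded VV] d'(6)] .
  \<comment> \<open>Matches indices that name the same member of A.\<close>
  define \<pi> where "\<pi> = inv_into {1..k} \<Gamma>' \<circ> \<Gamma>"
  have \<pi>: "bij_betw \<pi> {1..k} {1..k}"
    unfolding \<pi>_def using bij_betw_trans[OF d(1) bij_betw_inv_into[OF d'(1)]] .
  have \<Gamma>\<pi>: "\<Gamma>' (\<pi> i) = \<Gamma> i" if "i \<in> {1..k}" for i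
  proof -
    have "\<Gamma> i \<in> \<Gamma>' ` {1..k}" using d(1) d'(1) that by (metis bij_betw_def imageI)
    then show ?thesis unfolding \<pi>_def comp_apply by (rule f_inv_into_f)
  qed
  have piD: "\<pi> i \<in> {1..k}" if "i \<in> {1..k}" for i using \<pi> that bij_betwE by blast
  define c1 where "c1 = (\<lambda>(i, \<alpha>). \<tau> i \<alpha>)"
  define c2 where "c2 = (\<lambda>(i, \<alpha>). \<tau>' (\<pi> i) \<alpha>)"
  have c1: "c1 ` ({1..k} \<times> \<Omega>) = (\<Union>i\<in>{1..k}. \<tau> i ` \<Omega>)"
    by (force simp: c1_def)
  have "c2 ` ({1..k} \<times> \<Omega>) = (\<Union>i\<in>\<pi> ` {1..k}. \<tau>' i ` \<Omega>)"
    by (force simp: c2_def)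
  then have c2: "c2 ` ({1..k} \<times> \<Omega>) = (\<Union>i\<in>{1..k}. \<tau>' i ` \<Omega>)"
    unfolding bij_betw_imp_surj_on[OF \<pi>] .
  have "(\<Union>i\<in>{1..k}. \<tau> i ` \<Omega>) = (\<Union>i\<in>{1..k}. \<tau>' i ` \<Omega>)"
    using d(7) d'(7) VV by simp
  then have "c1 ` ({1..k} \<times> \<Omega>) = c2 ` ({1..k} \<times> \<Omega>)" using c1 c2 by simp
  moreover have "inj_on c1 ({1..k} \<times> \<Omega>)" using P.tau_inj by (simp add: c1_def)
  moreover have "inj_on c2 ({1..k} \<times> \<Omega>)"
  proof (rule inj_onI, clarify)
    fix i \<alpha> j \<beta>
    assume *: "i \<in> {1..k}" "\<alpha> \<in> \<Omega>" "j \<in> {1..k}" "\<beta> \<in> \<Omega>" "c2 (i, \<alpha>) = c2 (j, \<beta>)"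
    then have "\<tau>' (\<pi> i) \<alpha> = \<tau>' (\<pi> j) \<beta>" by (simp add: c2_def)
    then have "\<pi> i = \<pi> j \<and> \<alpha> = \<beta>"
      using Q.tau_eq_iff[OF piD[OF *(1)] *(2) piD[OF *(3)] *(4)] by blast
    then show "i = j \<and> \<alpha> = \<beta>"
      using inj_onD[OF bij_betw_imp_inj_on[OF \<pi>], of i j] *(1,3) by blast
  qed
  ultimately obtain p1 where "p1 permutes c1 ` ({1..k} \<times> \<Omega>)"
    and p1': "\<And>e. e \<in> {1..k} \<times> \<Omega> \<Longrightarrow> p1 (c1 e) = c2 e"
    using permutes_reindex by blast
  then have p1: "p1 permutes (\<Union>i\<in>{1..k}. \<tau> i ` \<Omega>)" using c1 by simp
  have p1_tau: "p1 (\<tau> i \<alpha>) = \<tau>' (\<pi> i) \<alpha>" if "i \<in> {1..k}" "\<alpha> \<in> \<Omega>" for i \<alpha>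
    using p1'[of "(i, \<alpha>)"] that by (simp add: c1_def c2_def)
  have inj: "inj_on (x' \<circ> \<pi>) {1..k}"
    using comp_inj_on[OF bij_betw_imp_inj_on[OF \<pi>], of x'] Q.x_inj bij_betw_imp_surj_on[OF \<pi>]
    by simp
  have img: "x ` {1..k} = (x' \<circ> \<pi>) ` {1..k}"
    using XX bij_betw_imp_surj_on[OF \<pi>] by (metis image_comp)
  obtain p2 where p2: "p2 permutes x ` {1..k}"
    and p2_x: "\<And>i. i \<in> {1..k} \<Longrightarrow> p2 (x i) = x' (\<pi> i)"
    using permutes_reindex[OF P.x_inj inj img] unfolding comp_apply by blast
  \<comment> \<open>\<open>p1\<close> moves only copies and \<open>p2\<close> only elements of X.
    The supports are disjoint, so p acts on each of them as the respective factor.\<close>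
  define p where "p = p1 \<circ> p2"
  have "(\<Union>i\<in>{1..k}. \<tau> i ` \<Omega>) \<subseteq> verts P.D - \<Omega>" "x ` {1..k} \<subseteq> verts P.D - \<Omega>"
    using P.tau_notin P.x_notin unfolding P.verts_D by blast+
  then have p: "p permutes verts P.D - \<Omega>"
    unfolding p_def by (intro permutes_compose permutes_subset[OF p1] permutes_subset[OF p2])
  have "act_ldigraph p P.D = Q.D"
  proof (rule act_psi_ldigraph[OF P.psi_data_axioms Q.psi_data_axioms permutes_bij[OF p] permutes_id \<pi>])
    show "p \<alpha> = id \<alpha>" if "\<alpha> \<in> \<Omega>" for \<alpha>
      using permutes_not_in[OF p, of \<alpha>] that by simp
    show "p (\<tau> i \<alpha>) = \<tau>' (\<pi> i) (id \<alpha>)" if "i \<in> {1..k}" "\<alpha> \<in> \<Omega>" for i \<alpha>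
    proof -
      have "\<tau> i \<alpha> \<notin> x ` {1..k}" using P.tau_neq_x that by blast
      then show ?thesis using permutes_not_in[OF p2] p1_tau[OF that] by (simp add: p_def)
    qed
    show "p (x i) = x' (\<pi> i)" if "i \<in> {1..k}" for i
    proof -
      have "x' (\<pi> i) \<in> x ` {1..k}" using XX piD that by blast
      then have "x' (\<pi> i) \<notin> (\<Union>i\<in>{1..k}. \<tau> i ` \<Omega>)" using P.tau_neq_x by auto
      then show ?thesis using permutes_not_in[OF p1] p2_x[OF that] by (simp add: p_def)
    qed
    show "\<Gamma>' (\<pi> i) = act_ldigraph id (\<Gamma> i)" if "i \<in> {1..k}" for i
      using \<Gamma>\<pi> that by simp
  qed
  then show ?thesis using extended_graph_of_act[OF p] k' by simp
qed

section \<open>The function \<open>psi\<close>: value, equivariance, codomain, injectivity\<close>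

lemma psi_value_ex1:
  assumes "finite \<Omega>" "infinite \<Lambda>" "well_order_on \<Lambda> r" "A \<in> finite_ldigraph_sets \<Omega> hash circast"
  shows "\<exists>!E. psi_value \<Omega> \<Lambda> r hash circast A E"
proof -
  have A: "finite A" "A \<subseteq> plain_ldigraphs \<Omega> hash circast"
    using assms(4) by (auto simp: finite_ldigraph_sets_def)
  obtain k \<Gamma> V \<tau> x where "psi_choice \<Omega> \<Lambda> r A k \<Gamma> V \<tau> x"
    using psi_choice_exists[OF assms(1-3) A(1)] by blast
  then show ?thesis
    unfolding psi_value_def using psi_choice_unique[OF _ _ A(2) assms(3)] by blast
qed

lemma psi_eqI:
  assumes "finite \<Omega>" "infinite \<Lambda>" "well_order_on \<Lambda> r" "A \<in> finite_ldigraph_sets \<Omega> hash circast"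
    and "psi_choice \<Omega> \<Lambda> r A k \<Gamma> V \<tau> x"
  shows "psi \<Omega> \<Lambda> r hash circast A = extended_graph_of \<Omega> (psi_ldigraph \<Omega> hash circast k \<Gamma> \<tau> x)"
  unfolding psi_def
proof (rule the1_equality[OF psi_value_ex1[OF assms(1-4)]])
  show "psi_value \<Omega> \<Lambda> r hash circast A
      (extended_graph_of \<Omega> (psi_ldigraph \<Omega> hash circast k \<Gamma> \<tau> x))"
    unfolding psi_value_def using assms(5) by blast
qed

text \<open>The parts and X lie outside \<Omega>, where g acts trivially, so they are kept.
  Precomposing \<open>\<tau> i\<close> with \<open>inv g\<close> preserves its image and makes g
  itself an isomorphism between the two digraphs.\<close>

lemma psi_choice_act:
  assumes g: "g permutes \<Omega>" and c: "psi_choice \<Omega> \<Lambda> r A k \<Gamma> V \<tau> x"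
  shows "psi_choice \<Omega> \<Lambda> r (act_set act_ldigraph g A) k (\<lambda>i. act_ldigraph g (\<Gamma> i)) V (\<lambda>i. \<tau> i \<circ> inv g) x"
proof -
  note d = c[unfolded psi_choice_def]
  have "act_ldigraph (inv g) (act_ldigraph g G) = G" for G :: "('a, 'c) ldigraph"
    using act_ldigraph_comp[OF permutes_bij[OF g] permutes_bij[OF permutes_inv[OF g]]]
      permutes_inv_o(2)[OF g] act_ldigraph_id by metis
  then have "inj_on (act_ldigraph g) A" by (metis inj_on_inverseI)
  then have "bij_betw (act_ldigraph g) A (act_set act_ldigraph g A)"
    by (simp add: bij_betw_def act_set_def)
  then have "bij_betw (\<lambda>i. act_ldigraph g (\<Gamma> i)) {1..k} (act_set act_ldigraph g A)"
    using bij_betw_trans[of \<Gamma> "{1..k}" A] d by (auto simp: comp_def)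
  moreover have "bij_betw (\<tau> i \<circ> inv g) \<Omega> (V i)" if "i \<in> {1..k}" for i
    using bij_betw_trans[OF permutes_imp_bij[OF permutes_inv[OF g]]] d that by blast
  ultimately show ?thesis using d by (simp add: psi_choice_def)
qed

lemma psi_act:
  assumes H: "finite \<Omega>" "infinite \<Lambda>" "well_order_on \<Lambda> r"
    and A: "A \<in> finite_ldigraph_sets \<Omega> hash circast" and g: "g permutes \<Omega>"
  shows "psi \<Omega> \<Lambda> r hash circast (act_set act_ldigraph g A) =
    act_extended_graph g (psi \<Omega> \<Lambda> r hash circast A)"
proof -
  have fA: "finite A" and pA: "A \<subseteq> plain_ldigraphs \<Omega> hash circast"
    using A by (auto simp: finite_ldigraph_sets_def)
  obtain k \<Gamma> V \<tau> x where c: "psi_choice \<Omega> \<Lambda> r A k \<Gamma> V \<tau> x"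
    using psi_choice_exists[OF H fA] by blast
  note c' = psi_choice_act[OF g c]
  note A' = act_set_finite_ldigraph_sets[OF g A]
  have pA': "act_set act_ldigraph g A \<subseteq> plain_ldigraphs \<Omega> hash circast"
    using A' by (simp add: finite_ldigraph_sets_def)
  interpret P: psi_data \<Omega> hash circast k \<Gamma> \<tau> x using c pA by (rule psi_choice_psi_data)
  interpret Q: psi_data \<Omega> hash circast k "\<lambda>i. act_ldigraph g (\<Gamma> i)" "\<lambda>i. \<tau> i \<circ> inv g" x
    using c' pA' by (rule psi_choice_psi_data)
  have "act_ldigraph g P.D = Q.D"
  \<comment> \<open>The renaming is g: it fixes the copies and the \<open>x i\<close>, and
    \<open>inv g\<close> in the new bijections cancels g on \<Omega>.\<close>
  proof (rule act_psi_ldigraph[OF P.psi_data_axioms Q.psi_data_axioms permutes_bij[OF g] g, where \<pi> = id])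
    show "g (\<tau> i \<alpha>) = (\<tau> (id i) \<circ> inv g) (g \<alpha>)" if "i \<in> {1..k}" "\<alpha> \<in> \<Omega>" for i \<alpha>
      using permutes_not_in[OF g P.tau_notin[OF that]] permutes_inverses(2)[OF g] by simp
    show "g (x i) = x (id i)" if "i \<in> {1..k}" for i
      using permutes_not_in[OF g P.x_notin[OF that]] by simp
  qed simp_all
  moreover have "\<Omega> \<subseteq> verts P.D" by (auto simp: P.verts_D)
  ultimately show ?thesis
    using psi_eqI[OF H A c] psi_eqI[OF H A' c'] act_extended_graph_of[OF g, of P.D] by simp
qed

lemma psi_in_extended_graphs:
  assumes H: "finite \<Omega>" "infinite \<Lambda>" "well_order_on \<Lambda> r" and sub: "\<Omega> \<subseteq> \<Lambda>"
    and A: "A \<in> finite_ldigraph_sets \<Omega> hash circast"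
  shows "psi \<Omega> \<Lambda> r hash circast A \<in> extended_graphs \<Omega> \<Lambda>"
proof -
  have fA: "finite A" and pA: "A \<subseteq> plain_ldigraphs \<Omega> hash circast"
    using A by (auto simp: finite_ldigraph_sets_def)
  obtain k \<Gamma> V \<tau> x where c: "psi_choice \<Omega> \<Lambda> r A k \<Gamma> V \<tau> x"
    using psi_choice_exists[OF H fA] by blast
  interpret P: psi_data \<Omega> hash circast k \<Gamma> \<tau> x using c pA by (rule psi_choice_psi_data)
  note d = psi_choiceD[OF c]
  have "verts P.D \<subseteq> \<Lambda>"
    using least_elements_subset[OF d(3)] least_elements_subset[OF d(6)] sub
    unfolding P.verts_D d(7) by blast
  moreover have "finite (verts P.D)" "\<Omega> \<subseteq> verts P.D" using H(1) by (auto simp: P.verts_D)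
  ultimately show ?thesis
    using psi_eqI[OF H A c] P.D_ldigraph unfolding extended_graphs_def by blast
qed

text \<open>A is recovered from an arbitrary member D of its value as the set of digraphs that D
  encodes. If two sets have the same value, any one D in it recovers both.\<close>

lemma psi_inj_on:
  assumes H: "finite \<Omega>" "infinite \<Lambda>" "well_order_on \<Lambda> r" and "\<Omega> \<noteq> {}" "hash \<noteq> circast"
  shows "inj_on (psi \<Omega> \<Lambda> r hash circast) (finite_ldigraph_sets \<Omega> hash circast)"
proof -
  have rep: "A = {G. encodes \<Omega> circast D G}"
    if A: "A \<in> finite_ldigraph_sets \<Omega> hash circast" and D: "D \<in> psi \<Omega> \<Lambda> r hash circast A" for A D
  proof -
    have fA: "finite A" and pA: "A \<subseteq> plain_ldigraphs \<Omega> hash circast"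
      using A by (auto simp: finite_ldigraph_sets_def)
    obtain k \<Gamma> V \<tau> x where c: "psi_choice \<Omega> \<Lambda> r A k \<Gamma> V \<tau> x"
      using psi_choice_exists[OF H fA] by blast
    interpret P: psi_data \<Omega> hash circast k \<Gamma> \<tau> x using c pA by (rule psi_choice_psi_data)
    have A_eq: "A = {G. encodes \<Omega> circast P.D G}"
      using c P.encodes_D_iff[OF assms(4,5)] by (auto simp: psi_choice_def bij_betw_def)
    obtain h where h: "h permutes (verts P.D - \<Omega>)" "D = act_ldigraph h P.D"
      using D psi_eqI[OF H A c] by (auto simp: extended_graph_of_def)
    then have fix_h: "h \<alpha> = \<alpha>" "inv h \<alpha> = \<alpha>" if "\<alpha> \<in> \<Omega>" for \<alpha>
      using permutes_not_in[OF h(1)] permutes_not_in[OF permutes_inv[OF h(1)]] that by blast+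
    note bh = permutes_bij[OF h(1)] permutes_bij[OF permutes_inv[OF h(1)]]
    have "act_ldigraph (inv h) D = P.D"
      using act_ldigraph_comp[OF bh] permutes_inv_o(2)[OF h(1)] h(2) act_ldigraph_id by metis
    \<comment> \<open>Invariance is used for h and for \<open>inv h\<close>, which both fix \<Omega>
      pointwise.\<close>
    then have "encodes \<Omega> circast P.D G \<longleftrightarrow> encodes \<Omega> circast D G" for G
      using encodes_act[OF bh(1), of \<Omega> circast P.D G] encodes_act[OF bh(2), of \<Omega> circast D G]
        fix_h h(2) by auto
    then show ?thesis using A_eq by simp
  qed
  \<comment> \<open>A common D exists because orbits are nonempty.\<close>
  have "\<exists>D. D \<in> psi \<Omega> \<Lambda> r hash circast A" if A: "A \<in> finite_ldigraph_sets \<Omega> hash circast" for A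
  proof -
    obtain k \<Gamma> V \<tau> x where "psi_choice \<Omega> \<Lambda> r A k \<Gamma> V \<tau> x"
      using psi_choice_exists[OF H, of A] A by (auto simp: finite_ldigraph_sets_def)
    then show ?thesis using psi_eqI[OF H A] self_in_extended_graph_of by metis
  qed
  with rep show ?thesis by (metis inj_onI)
qed

section \<open>Refiners from invariant injections\<close>

text \<open>Invariance turns \<open>act g (f a)\<close> into \<open>f (actX g a)\<close> and
  injectivity cancels f, so g carries \<open>f a\<close> to \<open>f b\<close> exactly when it
  carries a to b. Comparing the last entries of the extended stacks therefore imposes exactly
  membership in the transporter. Closure of X under the action is what allows injectivity to be
  applied to \<open>actX g a\<close>.\<close>

lemma perfect_refiner_Transp_const:
  assumes inv: "sym_invariant \<Omega> actX act X f" and inj: "inj_on f X" and "f \<in> X \<rightarrow> O'"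
    and closed: "\<And>g y. g permutes \<Omega> \<Longrightarrow> y \<in> X \<Longrightarrow> actX g y \<in> X"
    and "a \<in> X" "b \<in> X"
  shows "perfect_refiner \<Omega> act O' (Transp \<Omega> actX a b) (\<lambda>_. [f a]) (\<lambda>_. [f b])"
proof -
  have iff: "act g (f a) = f b \<longleftrightarrow> actX g a = b" if g: "g permutes \<Omega>" for g
  proof -
    have "act g (f a) = f (actX g a)" using inv g assms(5) by (simp add: sym_invariant_def)
    then show ?thesis using inj_on_eq_iff[OF inj closed[OF g assms(5)] assms(6)] by simp
  qed
  have "f a \<in> O'" "f b \<in> O'" using assms by auto
  then show ?thesis
    using iff by (auto simp: perfect_refiner_def refiner_def Transp_def act_list_def Stacks_def)
qed

theorem mainTheorem4:
  fixes \<Omega> \<Lambda> :: "'a set" and r :: "'a rel" and hash circast :: 'l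
  assumes "finite \<Omega>" and "\<Omega> \<noteq> {}"
    and "infinite \<Lambda>" and "\<Omega> \<subseteq> \<Lambda>"
    and "well_order_on \<Lambda> r"
    and "\<forall>\<alpha>\<in>\<Omega>. \<forall>\<beta>\<in>\<Lambda> - \<Omega>. (\<alpha>, \<beta>) \<in> r"
    and "hash \<noteq> circast"
  shows
    "(\<forall>A \<in> finite_ldigraph_sets \<Omega> hash circast. \<exists>!E. psi_value \<Omega> \<Lambda> r hash circast A E) \<and>
     psi \<Omega> \<Lambda> r hash circast \<in> finite_ldigraph_sets \<Omega> hash circast \<rightarrow> extended_graphs \<Omega> \<Lambda> \<and>
     inj_on (psi \<Omega> \<Lambda> r hash circast) (finite_ldigraph_sets \<Omega> hash circast) \<and>
     sym_invariant \<Omega> (act_set act_ldigraph) act_extended_graph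
       (finite_ldigraph_sets \<Omega> hash circast) (psi \<Omega> \<Lambda> r hash circast) \<and>
     (\<forall>A \<in> finite_ldigraph_sets \<Omega> hash circast. \<forall>B \<in> finite_ldigraph_sets \<Omega> hash circast.
        perfect_refiner \<Omega> act_extended_graph (extended_graphs \<Omega> \<Lambda>)
          (Transp \<Omega> (act_set act_ldigraph) A B)
          (\<lambda>_. [psi \<Omega> \<Lambda> r hash circast A]) (\<lambda>_. [psi \<Omega> \<Lambda> r hash circast B]))"
proof (intro conjI ballI)
  note H = assms(1,3,5)
  let ?F = "finite_ldigraph_sets \<Omega> hash circast" and ?f = "psi \<Omega> \<Lambda> r hash circast"
  show "\<exists>!E. psi_value \<Omega> \<Lambda> r hash circast A E" if "A \<in> ?F" for A
    using that by (rule psi_value_ex1[OF H])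
  show map: "?f \<in> ?F \<rightarrow> extended_graphs \<Omega> \<Lambda>"
    by (rule Pi_I) (rule psi_in_extended_graphs[OF H assms(4)])
  show inj: "inj_on ?f ?F"
    using psi_inj_on[OF H assms(2,7)] .
  show sym: "sym_invariant \<Omega> (act_set act_ldigraph) act_extended_graph ?F ?f"
    unfolding sym_invariant_def by (intro ballI allI impI psi_act[OF H])
  show "perfect_refiner \<Omega> act_extended_graph (extended_graphs \<Omega> \<Lambda>)
      (Transp \<Omega> (act_set act_ldigraph) A B) (\<lambda>_. [?f A]) (\<lambda>_. [?f B])"
    if "A \<in> ?F" "B \<in> ?F" for A B
    by (rule perfect_refiner_Transp_const[OF sym inj map act_set_finite_ldigraph_sets that])
qed

end
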